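(* There exists a $1$-PDDS$[P_2]$ in $\Lambda_2$ that is periodic but not lattice-like.
   Context: $\Lambda_2$ is the infinite graph with vertex set $\mathbb{Z}^2$ in which two vertices are adjacent iff their Euclidean distance is $1$; $d$ denotes graph distance. For $S$ a set of vertices, $[S]$ is the induced subgraph and $d(v,C)=\min\{d(v,w):w\in C\}$. For $t\ge1$, $S$ is a $t$-perfect distance-dominating set ($t$-PDDS) if for each vertex $v$ there is a unique component $C_v$ of $[S]$ with $d(v,C_v)\le t$, and there is in $C_v$ a unique vertex $w$ with $d(v,w)=d(v,C_v)$. A $t$-PDDS$[H]$ is a $t$-PDDS all of whose components are isomorphic to the fixed finite graph $H$; $P_2$ is the path on 2 vertices. A set $S\subset\mathbb{Z}^2$ is periodic if there are (positive) integers $p_1,p_2$ such that $v\in S$ implies $v\pm p_ie_i\in S$ for $i=1,2$, where $e_i$ are the unit vectors. For a subgraph $D$ and $z\in\mathbb{Z}^2$, $D+z$ is its translate by $z$. A $t$-PDDS$[H]$ $R$ is lattice-like if, for a component $D$ of $R$, there is a lattice $L$ (subgroup of $(\mathbb{Z}^2,+)$) such that $D'$ is a component of $R$ iff $D'=D+z$ for some $z\in L$. *)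

theory Defs
  imports
    "HOL-Analysis.Analysis"
    "HOL-Algebra.Elementary_Groups"
    "Graph_Theory.Graph_Theory"
begin

text \<open>
  As in the underlying graph library, undirected graphs are symmetric digraphs: an edge \<open>uv\<close> is
  the pair of arcs \<open>(u,v)\<close>, \<open>(v,u)\<close>, and the connected components of a graph are its \<open>sccs\<close>.
\<close>

type_synonym vertex = "int \<times> int"
type_synonym lattice_graph = "(vertex, vertex \<times> vertex) pre_digraph"

definition to_plane :: "vertex \<Rightarrow> real \<times> real" where
  "to_plane v = (real_of_int (fst v), real_of_int (snd v))"

definition Lambda2 :: lattice_graph where
  "Lambda2 = \<lparr>verts = UNIV, arcs = {(u, v). dist (to_plane u) (to_plane v) = 1},
              tail = fst, head = snd\<rparr>"

lemma sym_digraph_Lambda2: "sym_digraph Lambda2"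
  by unfold_locales
     (auto simp: Lambda2_def symmetric_def sym_def arcs_ends_def arc_to_ends_def dist_commute)

definition gdist :: "vertex \<Rightarrow> vertex \<Rightarrow> ereal" where
  "gdist u v = wf_digraph.\<mu> Lambda2 (\<lambda>_. 1) u v"

lemma gdist_eq: "gdist u v = (INF p\<in>{p. pre_digraph.awalk Lambda2 u p v}. ereal (length p))"
proof -
  interpret sym_digraph Lambda2 by (rule sym_digraph_Lambda2)
  show ?thesis
    by (simp add: gdist_def \<mu>_def awalk_cost_def sum_list_triv)
qed

text \<open>
  The infimum is a minimum when \<open>C\<close> has a vertex, since distances are natural numbers.
\<close>

definition gdist_to :: "vertex \<Rightarrow> lattice_graph \<Rightarrow> ereal" where
  "gdist_to v C = (INF w\<in>verts C. gdist v w)"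

definition comps :: "vertex set \<Rightarrow> lattice_graph set" where
  "comps S = pre_digraph.sccs (Lambda2 \<restriction> S)"

definition PDDS :: "nat \<Rightarrow> vertex set \<Rightarrow> bool" where
  "PDDS t S \<longleftrightarrow> (\<forall>v.
     (\<exists>!C. C \<in> comps S \<and> gdist_to v C \<le> ereal (real t)) \<and>
     (\<forall>C \<in> comps S. gdist_to v C \<le> ereal (real t) \<longrightarrow>
        (\<exists>!w. w \<in> verts C \<and> gdist v w = gdist_to v C)))"

definition PDDS_of :: "nat \<Rightarrow> ('a, 'b) pre_digraph \<Rightarrow> vertex set \<Rightarrow> bool" where
  "PDDS_of t H S \<longleftrightarrow> PDDS t S \<and> (\<forall>C \<in> comps S. digraph_iso C H)"

definition P2 :: "(nat, nat \<times> nat) pre_digraph" where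
  "P2 = \<lparr>verts = {0, 1}, arcs = {(0, 1), (1, 0)}, tail = fst, head = snd\<rparr>"

lemma graph_P2: "graph P2"
  by unfold_locales
     (auto simp: P2_def symmetric_def sym_def arcs_ends_def arc_to_ends_def)

definition periodic :: "vertex set \<Rightarrow> bool" where
  "periodic S \<longleftrightarrow> (\<exists>p1 p2 :: int. p1 > 0 \<and> p2 > 0 \<and>
     (\<forall>v \<in> S. v + (p1, 0) \<in> S \<and> v - (p1, 0) \<in> S \<and> v + (0, p2) \<in> S \<and> v - (0, p2) \<in> S))"

definition translate :: "lattice_graph \<Rightarrow> vertex \<Rightarrow> lattice_graph" where
  "translate D z = D\<lparr>verts := (\<lambda>v. v + z) ` verts D,
                     arcs := (\<lambda>(u, v). (u + z, v + z)) ` arcs D\<rparr>"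

definition lattice_like :: "vertex set \<Rightarrow> bool" where
  "lattice_like R \<longleftrightarrow> (\<exists>D \<in> comps R. \<exists>L. subgroup L (integer_group \<times>\<times> integer_group) \<and>
     (\<forall>D'. D' \<in> comps R \<longleftrightarrow> (\<exists>z \<in> L. D' = translate D z)))"

end

theory Submission
  imports Defs
begin

text \<open>
  If every vertex has exactly one neighbour in \<open>S\<close> (a total perfect code), then the components of
  \<open>[S]\<close> are single edges, and a component lies within distance 1 of \<open>v\<close> iff it contains the
  neighbour of \<open>v\<close> in \<open>S\<close>; so \<open>S\<close> is a 1-PDDS[\<open>P\<^sub>2\<close>].

  The neighbours of an even vertex are odd and conversely, so the even and the odd part of such a set
  can be chosen independently. In the coordinates \<open>x + y\<close>, \<open>x - y\<close>, the condition says that the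
  \<open>2 \<times> 2\<close> blocks based at the points of one parity class tile the plane. For the even part we take the
  lattice tiling, and for the odd part we shift every other row of it. This produces both horizontal
  and vertical edges, which cannot be translates of each other.
\<close>

section \<open>Adjacency and small distances in the grid\<close>

lemma arcs_Lambda2_iff:
  "((a, b), (c, d)) \<in> arcs Lambda2 \<longleftrightarrow> \<bar>a - c\<bar> + \<bar>b - d\<bar> = 1"
proof -
  have "((a, b), (c, d)) \<in> arcs Lambda2 \<longleftrightarrow>
      (real_of_int a - real_of_int c)\<^sup>2 + (real_of_int b - real_of_int d)\<^sup>2 = 1"
    by (simp add: Lambda2_def to_plane_def dist_Pair_Pair dist_real_def)
  also have "\<dots> \<longleftrightarrow> real_of_int ((a - c)\<^sup>2 + (b - d)\<^sup>2) = real_of_int 1"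
    by simp
  also have "\<dots> \<longleftrightarrow> (a - c)\<^sup>2 + (b - d)\<^sup>2 = 1"
    by (simp only: of_int_eq_iff)
  also have "\<dots> \<longleftrightarrow> \<bar>a - c\<bar> + \<bar>b - d\<bar> = 1"
  proof -
    \<comment> \<open>The Euclidean and the taxicab unit circle have the same four integer points;
      the taxicab form suits linear arithmetic.\<close>
    have sq: "x\<^sup>2 + y\<^sup>2 = 1 \<longleftrightarrow> \<bar>x\<bar> + \<bar>y\<bar> = 1" for x y :: int
    proof
      assume eq: "x\<^sup>2 + y\<^sup>2 = 1"
      have "x\<^sup>2 \<le> 1" "y\<^sup>2 \<le> 1"
        using eq zero_le_power2[of x] zero_le_power2[of y] by linarith+
      then have "\<bar>x\<bar> \<le> 1" "\<bar>y\<bar> \<le> 1"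
        by (simp_all add: abs_square_le_1)
      then have "x \<in> {-1, 0, 1}" "y \<in> {-1, 0, 1}"
        by auto
      with eq show "\<bar>x\<bar> + \<bar>y\<bar> = 1"
        by auto
    next
      assume eq: "\<bar>x\<bar> + \<bar>y\<bar> = 1"
      then have "x \<in> {-1, 0, 1}" "y \<in> {-1, 0, 1}"
        by auto
      with eq show "x\<^sup>2 + y\<^sup>2 = 1"
        by auto
    qed
    show ?thesis by (rule sq)
  qed
  finally show ?thesis .
qed

lemma arcs_Lambda2_sym: "(u, v) \<in> arcs Lambda2 \<longleftrightarrow> (v, u) \<in> arcs Lambda2"
  by (simp add: Lambda2_def dist_commute)

lemma arcs_Lambda2_irrefl: "(v, v) \<notin> arcs Lambda2"
  by (simp add: Lambda2_def)

lemma awalk_Lambda2_short: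
  assumes "pre_digraph.awalk Lambda2 u p v" and "length p \<le> 1"
  shows "u = v \<and> p = [] \<or> (u, v) \<in> arcs Lambda2 \<and> p = [(u, v)]"
  using assms
  by (cases p) (auto simp: pre_digraph.awalk_def pre_digraph.cas.simps Lambda2_def)

lemma gdist_self: "gdist v v = 0"
proof -
  have "pre_digraph.awalk Lambda2 v [] v"
    by (simp add: pre_digraph.awalk_def pre_digraph.cas.simps Lambda2_def)
  then have "gdist v v \<le> ereal (length ([] :: (vertex \<times> vertex) list))"
    unfolding gdist_eq by (intro INF_lower) simp
  moreover have "0 \<le> gdist v v"
    unfolding gdist_eq by (intro INF_greatest) simp
  ultimately show ?thesis by (simp add: zero_ereal_def antisym)
qed

lemma gdist_adj:
  assumes "(u, v) \<in> arcs Lambda2"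
  shows "gdist u v = 1"
proof (rule antisym)
  have "pre_digraph.awalk Lambda2 u [(u, v)] v"
    using assms by (auto simp: pre_digraph.awalk_def pre_digraph.cas.simps Lambda2_def)
  then have "gdist u v \<le> ereal (length [(u, v)])"
    unfolding gdist_eq by (intro INF_lower) simp
  then show "gdist u v \<le> 1"
    by (simp add: one_ereal_def)
  have "1 \<le> length p" if "pre_digraph.awalk Lambda2 u p v" for p
    using awalk_Lambda2_short[OF that] assms arcs_Lambda2_irrefl[of v] by (cases p) auto
  then show "1 \<le> gdist u v"
    unfolding gdist_eq by (intro INF_greatest) (auto simp: one_ereal_def)
qed

lemma gdist_nonadj:
  assumes "u \<noteq> v" and "(u, v) \<notin> arcs Lambda2"
  shows "gdist u v \<ge> 2"
proof -
  have "2 \<le> length p" if "pre_digraph.awalk Lambda2 u p v" for p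
    using awalk_Lambda2_short[OF that] assms by force
  then have "ereal 2 \<le> gdist u v"
    unfolding gdist_eq by (intro INF_greatest) fastforce
  then show ?thesis by simp
qed

text \<open>A distance is 0, 1 or at least 2 according to whether the vertices are equal, adjacent
  or neither. For radius 1 this replaces the infimum over walks by adjacency.\<close>

lemma gdist_le_1_iff: "gdist u v \<le> 1 \<longleftrightarrow> u = v \<or> (u, v) \<in> arcs Lambda2"
proof -
  have "\<not> (2 :: ereal) \<le> 1" by simp
  then show ?thesis
    using gdist_self gdist_adj gdist_nonadj
    by (metis order_trans order_refl zero_less_one_ereal less_imp_le)
qed

lemma gdist_to_edge: "gdist_to v (Lambda2 \<restriction> {a, b}) = min (gdist v a) (gdist v b)"
  by (simp add: gdist_to_def inf_min)

section \<open>Components and distances for a total perfect code\<close>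

lemma digraph_iso_edge_P2:
  assumes "(v, w) \<in> arcs Lambda2"
  shows "digraph_iso (Lambda2 \<restriction> {v, w}) P2"
proof -
  interpret L: sym_digraph Lambda2 by (rule sym_digraph_Lambda2)
  have ne: "v \<noteq> w"
    using assms arcs_Lambda2_irrefl[of w] by blast
  define f where "f x = (if x = v then 0 else 1 :: nat)" for x
  define h where "h = \<lparr>iso_verts = f, iso_arcs = map_prod f f, iso_head = snd, iso_tail = fst\<rparr>"
  have "tail Lambda2 = fst" "head Lambda2 = snd"
    by (simp_all add: Lambda2_def)
  then have arcs: "arcs (Lambda2 \<restriction> {v, w}) = {(v, w), (w, v)}"
    using assms arcs_Lambda2_sym[of v w] arcs_Lambda2_irrefl[of v] arcs_Lambda2_irrefl[of w]
    by auto
  have "wf_digraph (Lambda2 \<restriction> {v, w})"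
    by (rule L.wellformed_induce_subgraph)
  then have "pre_digraph.digraph_isomorphism (Lambda2 \<restriction> {v, w}) h"
    unfolding pre_digraph.digraph_isomorphism_def arcs
    using ne by (auto simp: h_def f_def inj_on_def Lambda2_def)
  moreover have "P2 = app_iso h (Lambda2 \<restriction> {v, w})"
    unfolding app_iso_def arcs P2_def
    using ne by (auto simp: h_def f_def)
  ultimately show ?thesis
    unfolding digraph_iso_def by blast
qed

text \<open>Applied to the vertices of \<open>S\<close> themselves, the hypothesis makes the induced
  subgraph 1-regular, so it is a disjoint union of edges.\<close>

lemma comps_total_perfect_code:
  assumes code: "\<And>v. \<exists>!w. w \<in> S \<and> (v, w) \<in> arcs Lambda2"
  shows "comps S = {Lambda2 \<restriction> {v, w} | v w. v \<in> S \<and> w \<in> S \<and> (v, w) \<in> arcs Lambda2}"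
proof -
  let ?G = "Lambda2 \<restriction> S"
  interpret L: sym_digraph Lambda2 by (rule sym_digraph_Lambda2)
  interpret G: wf_digraph ?G by (rule L.wellformed_induce_subgraph)
  have dom: "u \<rightarrow>\<^bsub>?G\<^esub> v \<longleftrightarrow> u \<in> S \<and> v \<in> S \<and> (u, v) \<in> arcs Lambda2" for u v
    by (auto simp: arcs_ends_def arc_to_ends_def Lambda2_def)
  have reach: "u \<rightarrow>\<^sup>*\<^bsub>?G\<^esub> v \<longleftrightarrow> u \<in> S \<and> v \<in> S \<and> (u = v \<or> (u, v) \<in> arcs Lambda2)" for u v
  proof
    assume "u \<rightarrow>\<^sup>*\<^bsub>?G\<^esub> v"
    then show "u \<in> S \<and> v \<in> S \<and> (u = v \<or> (u, v) \<in> arcs Lambda2)"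
    proof (induction rule: G.reachable_induct)
      case base
      then show ?case by simp
    next
      case (step x y)
      \<comment> \<open>If \<open>x = u\<close>, then \<open>y\<close> is adjacent to
        \<open>u\<close>. Otherwise \<open>u\<close> is the only neighbour of \<open>x\<close> in
        \<open>S\<close>, so the walk turns back and \<open>y = u\<close>.\<close>
      then show ?case
        using dom code[of x] arcs_Lambda2_sym by metis
    qed
  next
    assume "u \<in> S \<and> v \<in> S \<and> (u = v \<or> (u, v) \<in> arcs Lambda2)"
    then show "u \<rightarrow>\<^sup>*\<^bsub>?G\<^esub> v"
      using dom[of u v] G.reachable_adjI[of u v] G.reachable_refl[of u] by fastforce
  qed
  have verts: "T \<in> G.sccs_verts \<longleftrightarrow>
      (\<exists>v w. T = {v, w} \<and> v \<in> S \<and> w \<in> S \<and> (v, w) \<in> arcs Lambda2)" for T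
  proof
    assume T: "T \<in> G.sccs_verts"
    then obtain v where v: "v \<in> T"
      unfolding G.in_sccs_verts_conv_reachable by blast
    with T have vS: "v \<in> S"
      unfolding G.in_sccs_verts_conv_reachable reach by blast
    obtain w where w: "w \<in> S" "(v, w) \<in> arcs Lambda2"
      using code[of v] by blast
    have "w \<in> T"
      using T v vS w arcs_Lambda2_sym unfolding G.in_sccs_verts_conv_reachable reach by metis
    moreover have "x = v \<or> x = w" if "x \<in> T" for x
      using T that v w code[of v] unfolding G.in_sccs_verts_conv_reachable reach by metis
    ultimately have "T = {v, w}"
      using v by blast
    then show "\<exists>v w. T = {v, w} \<and> v \<in> S \<and> w \<in> S \<and> (v, w) \<in> arcs Lambda2"
      using vS w by blast
  next
    assume "\<exists>v w. T = {v, w} \<and> v \<in> S \<and> w \<in> S \<and> (v, w) \<in> arcs Lambda2"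
    then obtain v w where T: "T = {v, w}" and vw: "v \<in> S" "w \<in> S" "(v, w) \<in> arcs Lambda2"
      by blast
    have wv: "(w, v) \<in> arcs Lambda2"
      using vw arcs_Lambda2_sym by blast
    have "x = w" if "x \<in> S" "(v, x) \<in> arcs Lambda2" for x
      using that vw code[of v] by blast
    moreover have "x = v" if "x \<in> S" "(w, x) \<in> arcs Lambda2" for x
      using that vw wv code[of w] by blast
    ultimately show "T \<in> G.sccs_verts"
      unfolding G.in_sccs_verts_conv_reachable reach T using vw wv by blast
  qed
  have restrict: "?G \<restriction> {v, w} = Lambda2 \<restriction> {v, w}" if "v \<in> S" "w \<in> S" for v w
    using that by (auto simp: induce_subgraph_def)
  have "C \<in> comps S \<longleftrightarrow>
      (\<exists>v w. C = Lambda2 \<restriction> {v, w} \<and> v \<in> S \<and> w \<in> S \<and> (v, w) \<in> arcs Lambda2)" for C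
  proof -
    have "C \<in> comps S \<longleftrightarrow> (\<exists>T. T \<in> G.sccs_verts \<and> C = ?G \<restriction> T)"
      unfolding comps_def G.sccs_conv_sccs_verts by blast
    also have "\<dots> \<longleftrightarrow>
        (\<exists>v w. C = ?G \<restriction> {v, w} \<and> v \<in> S \<and> w \<in> S \<and> (v, w) \<in> arcs Lambda2)"
      unfolding verts by blast
    finally show ?thesis
      using restrict by metis
  qed
  then show ?thesis
    by blast
qed

lemma PDDS_of_total_perfect_code:
  assumes code: "\<And>v. \<exists>!w. w \<in> S \<and> (v, w) \<in> arcs Lambda2"
  shows "PDDS_of 1 P2 S"
proof -
  note comps = comps_total_perfect_code[OF code]
  have close: "gdist_to v C \<le> 1 \<longleftrightarrow> n \<in> verts C"
    if n: "n \<in> S" "(v, n) \<in> arcs Lambda2" and C: "C \<in> comps S" for v n C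
  proof -
    obtain a b where ab: "C = Lambda2 \<restriction> {a, b}" "a \<in> S" "b \<in> S" "(a, b) \<in> arcs Lambda2"
      using C comps by auto
    have "gdist_to v C \<le> 1 \<longleftrightarrow>
        v = a \<or> (v, a) \<in> arcs Lambda2 \<or> v = b \<or> (v, b) \<in> arcs Lambda2"
      unfolding ab(1) gdist_to_edge min_le_iff_disj gdist_le_1_iff by blast
    \<comment> \<open>If \<open>v\<close> is an endpoint of the edge, the other endpoint is its
      neighbour in \<open>S\<close>, hence \<open>n\<close>; if \<open>v\<close> is adjacent to an
      endpoint, that endpoint is \<open>n\<close>.\<close>
    also have "\<dots> \<longleftrightarrow> n = a \<or> n = b"
      using ab n code[of v] arcs_Lambda2_sym by metis
    finally show ?thesis
      using ab by simp
  qed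
  have "PDDS 1 S"
    unfolding PDDS_def
  proof (intro allI conjI ballI impI)
    fix v
    obtain n where n: "n \<in> S" "(v, n) \<in> arcs Lambda2"
      using code[of v] by blast
    obtain m where m: "m \<in> S" "(n, m) \<in> arcs Lambda2"
      using code[of n] by blast
    have m_unique: "x = m" if "x \<in> S" "(n, x) \<in> arcs Lambda2" for x
      using that m code[of n] by blast
    have n_unique: "x = n" if "x \<in> S" "(v, x) \<in> arcs Lambda2" for x
      using that n code[of v] by blast
    let ?C = "Lambda2 \<restriction> {n, m}"
    have C: "?C \<in> comps S"
      using comps n m by blast
    have eq: "C = ?C" if C: "C \<in> comps S" "n \<in> verts C" for C
    proof -
      obtain a b where ab: "C = Lambda2 \<restriction> {a, b}" "a \<in> S" "b \<in> S" "(a, b) \<in> arcs Lambda2"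
        using C comps by auto
      then have "n = a \<or> n = b"
        using C by simp
      then have "{a, b} = {n, m}"
        using ab m_unique arcs_Lambda2_sym by blast
      then show ?thesis
        using ab by simp
    qed
    show "\<exists>!C. C \<in> comps S \<and> gdist_to v C \<le> ereal (real 1)"
    proof (rule ex1I[of _ ?C])
      show "?C \<in> comps S \<and> gdist_to v ?C \<le> ereal (real 1)"
        using C close[OF n C] by (simp add: one_ereal_def)
      show "C = ?C" if "C \<in> comps S \<and> gdist_to v C \<le> ereal (real 1)" for C
        using that eq[of C] close[OF n, of C] by (simp add: one_ereal_def)
    qed
    fix C
    assume "C \<in> comps S" "gdist_to v C \<le> ereal (real 1)"
    then have Ceq: "C = ?C"
      using eq[of C] close[OF n, of C] by (simp add: one_ereal_def)
    have gn: "gdist v n = 1"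
      using n(2) by (rule gdist_adj)
    show "\<exists>!w. w \<in> verts C \<and> gdist v w = gdist_to v C"
    \<comment> \<open>If \<open>v = m\<close>, then \<open>v\<close> lies in the component and is
      its own nearest vertex. Otherwise \<open>n\<close> is at distance 1 and \<open>m\<close> is
      farther away, since adjacency of \<open>v\<close> and \<open>m\<close> would force
      \<open>m = n\<close>.\<close>
    proof (cases "v = m")
      case True
      then have "gdist v m = 0"
        by (simp add: gdist_self)
      then show ?thesis
        unfolding Ceq gdist_to_edge using gn by (intro ex1I[of _ m]) auto
    next
      case False
      have "(v, m) \<notin> arcs Lambda2"
        using m n_unique arcs_Lambda2_irrefl by blast
      with False have "\<not> gdist v m \<le> 1"
        by (simp add: gdist_le_1_iff)
      then show ?thesis
        unfolding Ceq gdist_to_edge using gn by (intro ex1I[of _ n]) auto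
    qed
  qed
  moreover have "digraph_iso C P2" if "C \<in> comps S" for C
    using that comps digraph_iso_edge_P2 by auto
  ultimately show ?thesis
    unfolding PDDS_of_def by blast
qed

section \<open>Perpendicular components and the explicit code\<close>

lemma not_lattice_like_if_perpendicular:
  assumes "Lambda2 \<restriction> {u, u + (1, 0)} \<in> comps S" and "Lambda2 \<restriction> {v, v + (0, 1)} \<in> comps S"
  shows "\<not> lattice_like S"
proof
  assume "lattice_like S"
  then obtain D y z where "translate D y = Lambda2 \<restriction> {u, u + (1, 0)}"
    and "translate D z = Lambda2 \<restriction> {v, v + (0, 1)}"
    using assms unfolding lattice_like_def by metis
  then have "verts (translate D y) = {u, u + (1, 0)}" "verts (translate D z) = {v, v + (0, 1)}"
    by simp_all
  then have y: "{u, u + (1, 0)} = (\<lambda>x. x + y) ` verts D"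
    and z: "{v, v + (0, 1)} = (\<lambda>x. x + z) ` verts D"
    by (simp_all add: translate_def)
  \<comment> \<open>Eliminating \<open>D\<close> makes the two edges translates of each other.
    Translation keeps the difference of the endpoints up to sign, which is \<open>(1, 0)\<close> for
    one edge and \<open>(0, 1)\<close> for the other.\<close>
  have "(\<lambda>x. x + (z - y)) ` {u, u + (1, 0)} = {v, v + (0, 1)}"
    unfolding y z by (simp add: image_image)
  then show False
    by (cases u; cases v; cases y; cases z) (auto simp: doubleton_eq_iff)
qed

text \<open>The first line is the even part. The other two are the odd part, whose rows
  \<open>x + y = c\<close> with \<open>c\<close> congruent to 1 modulo 4 are alternately shifted by
  2 in \<open>x - y\<close>; hence the modulus 8. An even point of the code has its partner to the
  right if \<open>x + y\<close> is 0 modulo 8, and above it if \<open>x + y\<close> is 4 modulo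
  8.\<close>

definition brick_code :: "vertex set" where
  "brick_code = {(x, y).
     (x + y) mod 4 = 0 \<and> (x - y) mod 4 = 0 \<or>
     (x + y) mod 8 = 1 \<and> (x - y) mod 4 = 1 \<or>
     (x + y) mod 8 = 5 \<and> (x - y) mod 4 = 3}"

lemma brick_code_total_perfect: "\<exists>!w. w \<in> brick_code \<and> (v, w) \<in> arcs Lambda2"
proof -
  obtain x y where v: "v = (x, y)"
    by (cases v)
  have nb: "((x, y), w) \<in> arcs Lambda2 \<longleftrightarrow>
      w = (x + 1, y) \<or> w = (x - 1, y) \<or> w = (x, y + 1) \<or> w = (x, y - 1)" for w
    by (cases w) (auto simp: arcs_Lambda2_iff)
  define a b where "a = x + y" and "b = x - y"
  \<comment> \<open>Membership depends only on these residues. As \<open>a - b = 2 * y\<close> is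
    even, \<open>r\<close> and \<open>s\<close> have equal parity, which leaves 16 cases.\<close>
  define r s where "r = a mod 8" and "s = b mod 4"
  have "r \<in> {0, 1, 2, 3, 4, 5, 6, 7}" "s \<in> {0, 1, 2, 3}"
    using pos_mod_bound[of 8 a] pos_mod_sign[of 8 a] pos_mod_bound[of 4 b] pos_mod_sign[of 4 b]
    unfolding r_def s_def by (simp, linarith)+
  moreover have "even r \<longleftrightarrow> even s"
    by (simp add: r_def s_def a_def b_def dvd_mod_iff)
  ultimately have rs: "(r, s) \<in> {0, 2, 4, 6} \<times> {0, 2} \<union> {1, 3, 5, 7} \<times> {1, 3}"
    by (elim insertE emptyE) simp_all
  \<comment> \<open>\<open>P i j\<close> is membership of the point whose coordinates
    \<open>a\<close>, \<open>b\<close> are increased by \<open>i\<close>, \<open>j\<close>. The four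
    neighbours correspond to the four sign choices for \<open>i\<close> and \<open>j\<close> in {1,
    -1}.\<close>
  define P where "P i j \<longleftrightarrow>
     (r + i) mod 4 = 0 \<and> (s + j) mod 4 = 0 \<or>
     (r + i) mod 8 = 1 \<and> (s + j) mod 4 = 1 \<or>
     (r + i) mod 8 = 5 \<and> (s + j) mod 4 = 3" for i j
  have shift: "(a + i) mod 4 = (r + i) mod 4" "(a + i) mod 8 = (r + i) mod 8"
    "(b + i) mod 4 = (s + i) mod 4" for i
    unfolding r_def s_def by (rule mod_add_cong; simp add: mod_mod_cancel)+
  have mem: "(x + i, y + j) \<in> brick_code \<longleftrightarrow> P (i + j) (i - j)" for i j
  proof -
    have "x + i + (y + j) = a + (i + j)" "x + i - (y + j) = b + (i - j)"
      by (simp_all add: a_def b_def)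
    then show ?thesis
      unfolding brick_code_def P_def by (simp only: shift mem_Collect_eq case_prod_conv)
  qed
  have E: "(x + 1, y) \<in> brick_code \<longleftrightarrow> P 1 1" and W: "(x - 1, y) \<in> brick_code \<longleftrightarrow> P (- 1) (- 1)"
    and N: "(x, y + 1) \<in> brick_code \<longleftrightarrow> P 1 (- 1)" and S: "(x, y - 1) \<in> brick_code \<longleftrightarrow> P (- 1) 1"
    using mem[of 1 0] mem[of "- 1" 0] mem[of 0 1] mem[of 0 "- 1"] by simp_all
  have "P 1 1 \<and> \<not> P (- 1) (- 1) \<and> \<not> P 1 (- 1) \<and> \<not> P (- 1) 1 \<or>
      \<not> P 1 1 \<and> P (- 1) (- 1) \<and> \<not> P 1 (- 1) \<and> \<not> P (- 1) 1 \<or>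
      \<not> P 1 1 \<and> \<not> P (- 1) (- 1) \<and> P 1 (- 1) \<and> \<not> P (- 1) 1 \<or>
      \<not> P 1 1 \<and> \<not> P (- 1) (- 1) \<and> \<not> P 1 (- 1) \<and> P (- 1) 1"
    using rs unfolding P_def by (elim UnE SigmaE insertE emptyE) simp_all
  then show ?thesis
    unfolding v nb by (elim disjE) (use E W N S in blast)+
qed

lemma periodic_brick_code: "periodic brick_code"
proof -
  \<comment> \<open>A step of 8 along either axis changes both \<open>x + y\<close> and
    \<open>x - y\<close> by 8 or -8, a multiple of both moduli.\<close>
  have mod8: "((a :: int) + 8) mod 8 = a mod 8" "(a - 8) mod 8 = a mod 8"
    "(a + 8) mod 4 = a mod 4" "(a - 8) mod 4 = a mod 4" for a
    by presburger+
  have "v + (8, 0) \<in> brick_code \<and> v - (8, 0) \<in> brick_code \<and>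
      v + (0, 8) \<in> brick_code \<and> v - (0, 8) \<in> brick_code" if v: "v \<in> brick_code" for v
  proof -
    obtain x y where xy: "v = (x, y)"
      by (cases v)
    have "x + 8 + y = (x + y) + 8" "x + 8 - y = (x - y) + 8"
      "x - 8 + y = (x + y) - 8" "x - 8 - y = (x - y) - 8"
      "x + (y + 8) = (x + y) + 8" "x - (y + 8) = (x - y) - 8"
      "x + (y - 8) = (x + y) - 8" "x - (y - 8) = (x - y) + 8"
      by simp_all
    then show ?thesis
      using v unfolding xy brick_code_def by (simp only: mod8 mem_Collect_eq case_prod_conv
        add_Pair diff_Pair add_0_right diff_0_right simp_thms)
  qed
  then show ?thesis
    unfolding periodic_def by (intro exI[of _ 8]) simp
qed

theorem theorem11:
  shows "\<exists>S :: vertex set. PDDS_of 1 P2 S \<and> periodic S \<and> \<not> lattice_like S"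
proof (intro exI conjI)
  show "PDDS_of 1 P2 brick_code"
    by (rule PDDS_of_total_perfect_code) (rule brick_code_total_perfect)
  show "periodic brick_code"
    by (rule periodic_brick_code)
  have "Lambda2 \<restriction> {v, w} \<in> comps brick_code"
    if "v \<in> brick_code" "w \<in> brick_code" "(v, w) \<in> arcs Lambda2" for v w
    using that comps_total_perfect_code[OF brick_code_total_perfect] by blast
  \<comment> \<open>The sums \<open>x + y\<close> at \<open>(0, 0)\<close> and \<open>(4, 0)\<close>
    are 0 and 4 modulo 8, so their partners lie in an unshifted and a shifted odd row: one edge is
    horizontal, the other vertical.\<close>
  then have "Lambda2 \<restriction> {(0, 0), (0, 0) + (1, 0)} \<in> comps brick_code"
    and "Lambda2 \<restriction> {(4, 0), (4, 0) + (0, 1)} \<in> comps brick_code"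
    by (auto simp: brick_code_def arcs_Lambda2_iff)
  then show "\<not> lattice_like brick_code"
    by (rule not_lattice_like_if_perpendicular)
qed

end
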